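(* Let $n\ge5$, $\beta\in\mathbb{C}$, and let $(\mathfrak{s}^{1}_{n,1}(\beta),\cdot,[-,-])$ be a transposed Poisson algebra structure on the Lie algebra $\mathfrak{s}^{1}_{n,1}(\beta)$. Then the multiplication $\cdot$ has (in the given basis if $\beta\neq n-2$, and up to isomorphism if $\beta=n-2$) one of the following forms, for some complex numbers $\alpha_j,\beta_1,\dots,\beta_5$, where products of basis elements that are not listed (up to commutativity) are zero. If $\beta=1$, $\mathbf{TP}_1$: $e_1\cdot e_1=\sum_{j=3}^n\alpha_je_j$, $e_1\cdot x=\sum_{t=2}^{n-1}(t-2)\alpha_{t+1}e_t+\beta_3e_n$, $x\cdot x=\sum_{t=2}^{n-2}(t-2)(t-1)\alpha_{t+2}e_t+(n-3)\beta_3e_{n-1}+\beta_5e_n$. If $\beta=2$, $\mathbf{TP}_2$: $e_1\cdot e_1=\sum_{j=2}^n\alpha_je_j$, $e_1\cdot x=\sum_{t=2}^{n-1}(t-1)\alpha_{t+1}e_t+\beta_3e_n$, $x\cdot x=\sum_{t=2}^{n-2}(t^2-t)\alpha_{t+2}e_t+(n-2)\beta_3e_{n-1}+\beta_5e_n$. If $\beta=n-2$, one of: $\mathbf{TP}_3$: $e_1\cdot e_1=\sum_{j=5}^n\alpha_je_j$, $e_1\cdot e_2=\beta_1e_n$, $e_2\cdot e_2=\beta_2e_n$, $e_1\cdot x=\sum_{t=4}^{n-1}(n+t-5)\alpha_{t+1}e_t+\beta_3e_n$, $e_2\cdot x=\beta_4e_n$, $x\cdot x=\sum_{t=3}^{n-2}(n+t-5)(n+t-4)\alpha_{t+2}e_t+(2n-6)\beta_3e_{n-1}+\beta_5e_n$;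 $\mathbf{TP}_4$: $e_1\cdot e_1=e_4+\sum_{j=5}^n\alpha_je_j$, $e_1\cdot x=(n-2)e_3+\sum_{t=4}^{n-1}(n+t-5)\alpha_{t+1}e_t+\beta_3e_n$, $e_2\cdot x=\beta_4e_n$, $x\cdot x=(n-3)(n-2)e_2+\sum_{t=3}^{n-2}(n+t-5)(n+t-4)\alpha_{t+2}e_t+(2n-6)\beta_3e_{n-1}+\beta_5e_n$. If $\beta\ne1,2,n-2$, $\mathbf{TP}_5$: $e_1\cdot e_1=\sum_{j=4}^n\alpha_je_j$, $e_1\cdot x=\sum_{t=3}^{n-1}(t-3+\beta)\alpha_{t+1}e_t+\beta_3e_n$, $x\cdot x=\sum_{t=2}^{n-2}(t-3+\beta)(t-2+\beta)\alpha_{t+2}e_t+(n-4+\beta)\beta_3e_{n-1}+\beta_5e_n$.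
   Context: All algebras are over $\mathbb{C}$. A transposed Poisson algebra is a vector space $\mathfrak{L}$ with bilinear operations $\cdot$ and $[-,-]$ such that $(\mathfrak{L},\cdot)$ is a commutative associative algebra, $(\mathfrak{L},[-,-])$ is a Lie algebra, and $2z\cdot[u,v]=[z\cdot u,v]+[u,z\cdot v]$ for all $u,v,z\in\mathfrak{L}$. A transposed Poisson structure on a Lie algebra $(\mathfrak{L},[-,-])$ is an operation $\cdot$ making $(\mathfrak{L},\cdot,[-,-])$ a transposed Poisson algebra. An isomorphism of transposed Poisson algebras is a linear bijection preserving both operations (so two structures on the same Lie algebra are isomorphic iff some Lie algebra automorphism carries one product to the other). $\mathfrak{s}^{1}_{n,1}(\beta)$ is the $(n+1)$-dimensional Lie algebra with basis $e_1,\dots,e_n,x$ and brackets $[e_i,e_1]=e_{i+1}$ for $2\le i\le n-1$; $[e_1,x]=e_1$; $[e_i,x]=(i-2+\beta)e_i$ for $2\le i\le n$; brackets of basis elements not determined by these and antisymmetry are zero. *)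

theory Defs
  imports Complex_Main
begin

definition bilinear_op ::
    "(complex \<Rightarrow> 'a \<Rightarrow> 'a) \<Rightarrow> ('a::ab_group_add \<Rightarrow> 'a \<Rightarrow> 'a) \<Rightarrow> bool" where
  "bilinear_op scale f \<longleftrightarrow>
     (\<forall>u. Vector_Spaces.linear scale scale (\<lambda>v. f u v)) \<and>
     (\<forall>v. Vector_Spaces.linear scale scale (\<lambda>u. f u v))"

locale lie_algebra = vector_space scale
  for scale :: "complex \<Rightarrow> 'a::ab_group_add \<Rightarrow> 'a" +
  fixes bracket :: "'a \<Rightarrow> 'a \<Rightarrow> 'a"
  assumes bracket_bilinear: "bilinear_op scale bracket"
    and bracket_alternating: "bracket u u = 0"
    and bracket_jacobi:
      "bracket u (bracket v w) + bracket v (bracket w u) + bracket w (bracket u v) = 0"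

locale transposed_poisson_algebra = lie_algebra scale bracket
  for scale :: "complex \<Rightarrow> 'a::ab_group_add \<Rightarrow> 'a" and bracket :: "'a \<Rightarrow> 'a \<Rightarrow> 'a" +
  fixes mult :: "'a \<Rightarrow> 'a \<Rightarrow> 'a"
  assumes mult_bilinear: "bilinear_op scale mult"
    and mult_commute: "mult u v = mult v u"
    and mult_assoc: "mult (mult u v) w = mult u (mult v w)"
    and transposed_leibniz:
      "scale 2 (mult z (bracket u v)) = bracket (mult z u) v + bracket u (mult z v)"

definition tp_isomorphism ::
    "(complex \<Rightarrow> 'a \<Rightarrow> 'a) \<Rightarrow> ('a::ab_group_add \<Rightarrow> 'a \<Rightarrow> 'a) \<Rightarrow> ('a \<Rightarrow> 'a \<Rightarrow> 'a) \<Rightarrow>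
     (complex \<Rightarrow> 'b \<Rightarrow> 'b) \<Rightarrow> ('b::ab_group_add \<Rightarrow> 'b \<Rightarrow> 'b) \<Rightarrow> ('b \<Rightarrow> 'b \<Rightarrow> 'b) \<Rightarrow>
     ('a \<Rightarrow> 'b) \<Rightarrow> bool" where
  "tp_isomorphism scale bracket mult scale' bracket' mult' \<phi> \<longleftrightarrow>
     Vector_Spaces.linear scale scale' \<phi> \<and> bij \<phi> \<and>
     (\<forall>u v. \<phi> (bracket u v) = bracket' (\<phi> u) (\<phi> v)) \<and>
     (\<forall>u v. \<phi> (mult u v) = mult' (\<phi> u) (\<phi> v))"

text \<open>The ambient type carries the Lie algebra \<open>\<ss>\<^sup>1\<^sub>n\<^sub>,\<^sub>1(\<beta>)\<close> with the family
  \<open>e 1, \<dots>, e n, x\<close> as its distinguished basis; \<open>e\<close> is unconstrained outside \<open>{1..n}\<close>.\<close>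

locale s1_algebra = lie_algebra scale bracket
  for scale :: "complex \<Rightarrow> 'a::ab_group_add \<Rightarrow> 'a" and bracket :: "'a \<Rightarrow> 'a \<Rightarrow> 'a" +
  fixes n :: nat and \<beta> :: complex and e :: "nat \<Rightarrow> 'a" and x :: 'a
  assumes e_inj: "inj_on e {1..n}"
    and x_notin: "x \<notin> e ` {1..n}"
    and basis_independent: "\<not> dependent (insert x (e ` {1..n}))"
    and basis_span: "span (insert x (e ` {1..n})) = UNIV"
    and bracket_e_e1: "\<And>i. 2 \<le> i \<Longrightarrow> i \<le> n - 1 \<Longrightarrow> bracket (e i) (e 1) = e (i + 1)"
    and bracket_e1_x: "bracket (e 1) x = e 1"
    and bracket_e_x: "\<And>i. 2 \<le> i \<Longrightarrow> i \<le> n \<Longrightarrow>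
          bracket (e i) x = scale (of_nat i - 2 + \<beta>) (e i)"
    and bracket_en_e1: "bracket (e n) (e 1) = 0"
    and bracket_e_e: "\<And>i j. 2 \<le> i \<Longrightarrow> i \<le> n \<Longrightarrow> 2 \<le> j \<Longrightarrow> j \<le> n \<Longrightarrow>
          bracket (e i) (e j) = 0"

definition other_products_zero ::
    "('a \<Rightarrow> 'a \<Rightarrow> 'a::zero) \<Rightarrow> 'a set \<Rightarrow> ('a \<times> 'a) set \<Rightarrow> bool" where
  "other_products_zero mult B listed \<longleftrightarrow>
     (\<forall>u\<in>B. \<forall>v\<in>B. (u, v) \<notin> listed \<and> (v, u) \<notin> listed \<longrightarrow> mult u v = 0)"

definition TP1 ::
    "(complex \<Rightarrow> 'a::ab_group_add \<Rightarrow> 'a) \<Rightarrow> nat \<Rightarrow> (nat \<Rightarrow> 'a) \<Rightarrow> 'a \<Rightarrow>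
     ('a \<Rightarrow> 'a \<Rightarrow> 'a) \<Rightarrow> bool" where
  "TP1 scale n e x mult \<longleftrightarrow> (\<exists>(\<alpha> :: nat \<Rightarrow> complex) b3 b5.
     mult (e 1) (e 1) = (\<Sum>j=3..n. scale (\<alpha> j) (e j)) \<and>
     mult (e 1) x =
       (\<Sum>t=2..n-1. scale ((of_nat t - 2) * \<alpha> (t + 1)) (e t)) + scale b3 (e n) \<and>
     mult x x =
       (\<Sum>t=2..n-2. scale ((of_nat t - 2) * (of_nat t - 1) * \<alpha> (t + 2)) (e t))
       + scale ((of_nat n - 3) * b3) (e (n - 1)) + scale b5 (e n) \<and>
     other_products_zero mult (insert x (e ` {1..n}))
       {(e 1, e 1), (e 1, x), (x, x)})"

definition TP2 ::
    "(complex \<Rightarrow> 'a::ab_group_add \<Rightarrow> 'a) \<Rightarrow> nat \<Rightarrow> (nat \<Rightarrow> 'a) \<Rightarrow> 'a \<Rightarrow>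
     ('a \<Rightarrow> 'a \<Rightarrow> 'a) \<Rightarrow> bool" where
  "TP2 scale n e x mult \<longleftrightarrow> (\<exists>(\<alpha> :: nat \<Rightarrow> complex) b3 b5.
     mult (e 1) (e 1) = (\<Sum>j=2..n. scale (\<alpha> j) (e j)) \<and>
     mult (e 1) x =
       (\<Sum>t=2..n-1. scale ((of_nat t - 1) * \<alpha> (t + 1)) (e t)) + scale b3 (e n) \<and>
     mult x x =
       (\<Sum>t=2..n-2. scale (((of_nat t)\<^sup>2 - of_nat t) * \<alpha> (t + 2)) (e t))
       + scale ((of_nat n - 2) * b3) (e (n - 1)) + scale b5 (e n) \<and>
     other_products_zero mult (insert x (e ` {1..n}))
       {(e 1, e 1), (e 1, x), (x, x)})"

definition TP3 ::
    "(complex \<Rightarrow> 'a::ab_group_add \<Rightarrow> 'a) \<Rightarrow> nat \<Rightarrow> (nat \<Rightarrow> 'a) \<Rightarrow> 'a \<Rightarrow>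
     ('a \<Rightarrow> 'a \<Rightarrow> 'a) \<Rightarrow> bool" where
  "TP3 scale n e x mult \<longleftrightarrow> (\<exists>(\<alpha> :: nat \<Rightarrow> complex) b1 b2 b3 b4 b5.
     mult (e 1) (e 1) = (\<Sum>j=5..n. scale (\<alpha> j) (e j)) \<and>
     mult (e 1) (e 2) = scale b1 (e n) \<and>
     mult (e 2) (e 2) = scale b2 (e n) \<and>
     mult (e 1) x =
       (\<Sum>t=4..n-1. scale ((of_nat n + of_nat t - 5) * \<alpha> (t + 1)) (e t)) + scale b3 (e n) \<and>
     mult (e 2) x = scale b4 (e n) \<and>
     mult x x =
       (\<Sum>t=3..n-2. scale ((of_nat n + of_nat t - 5) * (of_nat n + of_nat t - 4) * \<alpha> (t + 2)) (e t))
       + scale ((2 * of_nat n - 6) * b3) (e (n - 1)) + scale b5 (e n) \<and>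
     other_products_zero mult (insert x (e ` {1..n}))
       {(e 1, e 1), (e 1, e 2), (e 2, e 2), (e 1, x), (e 2, x), (x, x)})"

definition TP4 ::
    "(complex \<Rightarrow> 'a::ab_group_add \<Rightarrow> 'a) \<Rightarrow> nat \<Rightarrow> (nat \<Rightarrow> 'a) \<Rightarrow> 'a \<Rightarrow>
     ('a \<Rightarrow> 'a \<Rightarrow> 'a) \<Rightarrow> bool" where
  "TP4 scale n e x mult \<longleftrightarrow> (\<exists>(\<alpha> :: nat \<Rightarrow> complex) b3 b4 b5.
     mult (e 1) (e 1) = e 4 + (\<Sum>j=5..n. scale (\<alpha> j) (e j)) \<and>
     mult (e 1) x = scale (of_nat n - 2) (e 3)
       + (\<Sum>t=4..n-1. scale ((of_nat n + of_nat t - 5) * \<alpha> (t + 1)) (e t)) + scale b3 (e n) \<and>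
     mult (e 2) x = scale b4 (e n) \<and>
     mult x x = scale ((of_nat n - 3) * (of_nat n - 2)) (e 2)
       + (\<Sum>t=3..n-2. scale ((of_nat n + of_nat t - 5) * (of_nat n + of_nat t - 4) * \<alpha> (t + 2)) (e t))
       + scale ((2 * of_nat n - 6) * b3) (e (n - 1)) + scale b5 (e n) \<and>
     other_products_zero mult (insert x (e ` {1..n}))
       {(e 1, e 1), (e 1, x), (e 2, x), (x, x)})"

definition TP5 ::
    "(complex \<Rightarrow> 'a::ab_group_add \<Rightarrow> 'a) \<Rightarrow> nat \<Rightarrow> complex \<Rightarrow> (nat \<Rightarrow> 'a) \<Rightarrow> 'a \<Rightarrow>
     ('a \<Rightarrow> 'a \<Rightarrow> 'a) \<Rightarrow> bool" where
  "TP5 scale n \<beta> e x mult \<longleftrightarrow> (\<exists>(\<alpha> :: nat \<Rightarrow> complex) b3 b5.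
     mult (e 1) (e 1) = (\<Sum>j=4..n. scale (\<alpha> j) (e j)) \<and>
     mult (e 1) x =
       (\<Sum>t=3..n-1. scale ((of_nat t - 3 + \<beta>) * \<alpha> (t + 1)) (e t)) + scale b3 (e n) \<and>
     mult x x =
       (\<Sum>t=2..n-2. scale ((of_nat t - 3 + \<beta>) * (of_nat t - 2 + \<beta>) * \<alpha> (t + 2)) (e t))
       + scale ((of_nat n - 4 + \<beta>) * b3) (e (n - 1)) + scale b5 (e n) \<and>
     other_products_zero mult (insert x (e ` {1..n}))
       {(e 1, e 1), (e 1, x), (x, x)})"

end

theory Submission
  imports Defs
begin

text \<open>Multiplication by a fixed element of a transposed Poisson algebra is a half-derivation
  of the Lie algebra. Comparing coordinates in the half-derivation identity shows that such a map
  \<open>f\<close> of \<open>\<ss>\<^sup>1\<^sub>n\<^sub>,\<^sub>1(\<beta>)\<close> is a scalar \<open>a\<close> plus a map killing \<open>e 3, \<dots>, e n\<close>, sending \<open>e 2\<close> to a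
  multiple of \<open>e n\<close> (nonzero only if \<open>\<beta> = n - 2\<close>), and whose value at \<open>x\<close> is determined, up to the
  coefficient of \<open>e n\<close>, by its value at \<open>e 1\<close>. Commutativity of the product forces \<open>a = 0\<close> for all
  multiplication operators and \<open>e 1 \<cdot> e 2 = 0\<close>, and then links the rows of the multiplication table.
  Associativity matters only for \<open>\<beta> = n - 2\<close>, where it gives \<open>\<alpha> 4 = 0\<close> or \<open>e 2 \<cdot> e 2 = 0\<close>; in the
  second case scaling \<open>e 2, \<dots>, e n\<close> simultaneously normalises \<open>\<alpha> 4\<close> to \<open>1\<close>.\<close>

(* keeps the basis vector e 1 from being rewritten to e (Suc 0) *)
declare One_nat_def [simp del]

section \<open>Coordinates\<close>

context s1_algebra
begin

text \<open>Index 0 stands for \<open>x\<close>, so that the whole basis is indexed by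
  \<open>{..n}\<close> and linear maps can be treated as matrices.\<close>

definition bvec :: "nat \<Rightarrow> 'a" where
  "bvec j = (if j = 0 then x else e j)"

text \<open>Beyond \<open>n\<close> the vector \<open>e j\<close> is arbitrary and may coincide with
  a basis vector; the default 0 lets coordinate formulas hold there as well.\<close>

definition coord :: "nat \<Rightarrow> 'a \<Rightarrow> complex" where
  "coord j u = (if j \<le> n then representation (insert x (e ` {1..n})) u (bvec j) else 0)"

text \<open>These are the eigenvalues of bracketing with \<open>x\<close> on the right, see
  \<open>bracket_bvec_x\<close>.\<close>

definition wt :: "nat \<Rightarrow> complex" where
  "wt j = (if j = 0 then 0 else if j = 1 then 1 else of_nat j - 2 + \<beta>)"

lemma bvec_0 [simp]: "bvec 0 = x"
  and bvec_pos: "0 < j \<Longrightarrow> bvec j = e j"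
  by (auto simp: bvec_def)

lemma bvec_image: "bvec ` {..n} = insert x (e ` {1..n})"
proof -
  have "{..n} = insert 0 {1..n}" by auto
  then show ?thesis by (auto simp: bvec_def)
qed

lemma inj_on_bvec: "inj_on bvec {..n}"
proof -
  have atMost: "{..n} = insert 0 {1..n}" by auto
  have img: "bvec ` ({1..n} - {0}) = e ` {1..n}"
    by (intro image_cong) (auto simp: bvec_def)
  have "inj_on bvec {1..n} \<longleftrightarrow> inj_on e {1..n}"
    by (intro inj_on_cong) (auto simp: bvec_def)
  with img e_inj x_notin show ?thesis
    unfolding atMost inj_on_insert by simp
qed

lemma bvec_in_basis: "j \<le> n \<Longrightarrow> bvec j \<in> insert x (e ` {1..n})"
  using bvec_image by blast

lemma coord_add [simp]: "coord j (u + v) = coord j u + coord j v"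
  using basis_independent basis_span by (simp add: coord_def representation_add)

lemma coord_scale [simp]: "coord j (scale c u) = c * coord j u"
  using basis_independent basis_span by (simp add: coord_def representation_scale)

lemma coord_zero [simp]: "coord j 0 = 0"
  by (simp add: coord_def representation_zero)

lemma coord_minus [simp]: "coord j (- u) = - coord j u"
  using coord_scale[of j "- 1" u] by (simp del: coord_scale)

lemma coord_sum [simp]: "coord j (sum f A) = (\<Sum>a\<in>A. coord j (f a))"
  by (induction A rule: infinite_finite_induct) auto

lemma coord_bvec: "i \<le> n \<Longrightarrow> coord j (bvec i) = (if i = j then 1 else 0)"
  using basis_independent bvec_in_basis[of i] inj_on_bvec
  by (auto simp: coord_def representation_basis inj_on_def)

lemma coord_x [simp]: "coord j x = (if j = 0 then 1 else 0)"
  using coord_bvec[of 0] by auto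

lemma coord_e [simp]: "1 \<le> i \<Longrightarrow> i \<le> n \<Longrightarrow> coord j (e i) = (if i = j then 1 else 0)"
  using coord_bvec[of i] by (simp add: bvec_pos)

lemma coord_expand: "u = (\<Sum>j\<le>n. scale (coord j u) (bvec j))"
proof -
  have "u = (\<Sum>b\<in>insert x (e ` {1..n}). scale (representation (insert x (e ` {1..n})) u b) b)"
    using basis_independent by (intro sum_representation_eq[symmetric]) (auto simp: basis_span)
  also have "\<dots> = (\<Sum>j\<le>n. scale (representation (insert x (e ` {1..n})) u (bvec j)) (bvec j))"
    unfolding bvec_image[symmetric] using inj_on_bvec by (simp add: sum.reindex)
  finally show ?thesis by (simp add: coord_def)
qed

lemma coord_eqI: "(\<And>j. j \<le> n \<Longrightarrow> coord j u = coord j v) \<Longrightarrow> u = v"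
  by (subst coord_expand[of u], subst coord_expand[of v]) (auto intro: sum.cong)

lemma coord_sum_e:
  assumes "1 \<le> a" "b \<le> n"
  shows "coord j (\<Sum>t=a..b. scale (f t) (e t)) = (if a \<le> j \<and> j \<le> b then f j else 0)"
proof -
  have "coord j (\<Sum>t=a..b. scale (f t) (e t)) = (\<Sum>t=a..b. if t = j then f t else 0)"
    unfolding coord_sum using assms by (intro sum.cong) auto
  then show ?thesis by (simp add: sum.delta)
qed

lemma linear_expand:
  assumes "Vector_Spaces.linear scale scale f"
  shows "f u = (\<Sum>j\<le>n. scale (coord j u) (f (bvec j)))"
proof -
  interpret f: Vector_Spaces.linear scale scale f by fact
  show ?thesis
    by (subst coord_expand[of u]) (simp add: f.sum f.scale)
qed

section \<open>The bracket in coordinates\<close>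

lemma bracket_linear_left: "Vector_Spaces.linear scale scale (\<lambda>u. bracket u v)"
  and bracket_linear_right: "Vector_Spaces.linear scale scale (\<lambda>v. bracket u v)"
  using bracket_bilinear by (auto simp: bilinear_op_def)

lemma bracket_antisym: "bracket u v = - bracket v u"
proof -
  interpret l: Vector_Spaces.linear scale scale "\<lambda>u. bracket u w" for w
    by (rule bracket_linear_left)
  interpret r: Vector_Spaces.linear scale scale "\<lambda>v. bracket w v" for w
    by (rule bracket_linear_right)
  have "bracket (u + v) (u + v) = bracket u v + bracket v u"
    unfolding l.add r.add by (simp add: bracket_alternating)
  then show ?thesis by (simp add: bracket_alternating eq_neg_iff_add_eq_0)
qed

lemma bracket_bvec_x:
  assumes "j \<le> n"
  shows "bracket (bvec j) x = scale (wt j) (bvec j)"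
  using assms bracket_alternating[of x] bracket_e1_x bracket_e_x[of j]
  by (auto simp: bvec_def wt_def)

lemma coord_bracket_x: "coord j (bracket u x) = wt j * coord j u"
proof (cases "j \<le> n")
  case True
  have "coord j (bracket u x) = (\<Sum>i\<le>n. coord i u * (wt i * coord j (bvec i)))"
    by (subst linear_expand[OF bracket_linear_left]) (auto simp: bracket_bvec_x intro: sum.cong)
  also have "\<dots> = (\<Sum>i\<le>n. if i = j then coord j u * wt j else 0)"
    by (intro sum.cong) (auto simp: coord_bvec)
  finally show ?thesis using True by simp
qed (simp add: coord_def)

lemma bracket_bvec_e1:
  assumes "i \<le> n"
  shows "bracket (bvec i) (e 1) = (if i = 0 then - e 1 else if 2 \<le> i \<and> i < n then e (i + 1) else 0)"
proof -
  consider "i = 0" | "i = 1" | "2 \<le> i" "i < n" | "2 \<le> i" "i = n" using assms by linarith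
  then show ?thesis
  proof cases
    case 1 then show ?thesis using bracket_antisym[of x "e 1"] bracket_e1_x by simp
  next
    case 2 then show ?thesis by (simp add: bvec_def bracket_alternating)
  next
    case 3 then show ?thesis using bracket_e_e1[of i] by (simp add: bvec_def)
  next
    case 4 then show ?thesis using bracket_en_e1 by (simp add: bvec_def)
  qed
qed

lemma coord_bracket_e1:
  assumes "1 \<le> n"
  shows "coord j (bracket u (e 1)) =
    (if j = 1 then - coord 0 u else if 3 \<le> j \<and> j \<le> n then coord (j - 1) u else 0)"
proof -
  have "coord j (bracket u (e 1)) = (\<Sum>i\<le>n. coord i u * coord j (bracket (bvec i) (e 1)))"
    by (subst linear_expand[OF bracket_linear_left]) simp
  \<comment> \<open>At most one basis vector contributes to coordinate \<open>j\<close>: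
    \<open>x\<close> for \<open>j = 1\<close>, and \<open>e (j - 1)\<close> for \<open>j\<close>
    from 3 to \<open>n\<close>. For every other \<open>j\<close> the selected summand is 0.\<close>
  also have "\<dots> = (\<Sum>i\<le>n. if i = (if j = 1 then 0 else j - 1) then
      (if j = 1 then - coord 0 u else if 3 \<le> j \<and> j \<le> n then coord (j - 1) u else 0) else 0)"
    using assms by (intro sum.cong refl) (auto simp: bracket_bvec_e1)
  also have "\<dots> = (if j = 1 then - coord 0 u else if 3 \<le> j \<and> j \<le> n then coord (j - 1) u else 0)"
    by (subst sum.delta) auto
  finally show ?thesis .
qed

lemma bracket_e_expand:
  assumes "2 \<le> i" "i \<le> n"
  shows "bracket (e i) u = scale (coord 0 u * wt i) (e i) +
    (if i < n then scale (coord 1 u) (e (i + 1)) else 0)"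
proof -
  have split: "{..n} = insert 0 (insert 1 {2..n})" using assms by auto
  have "bracket (e i) (e 1) = (if i < n then e (i + 1) else 0)"
    using assms bracket_e_e1[of i] bracket_en_e1 by (cases "i = n") auto
  moreover have "(\<Sum>j\<in>{2..n}. scale (coord j u) (bracket (e i) (bvec j))) = 0"
    using assms bracket_e_e by (intro sum.neutral) (auto simp: bvec_def)
  ultimately show ?thesis
    using assms bracket_e_x[of i]
    by (subst linear_expand[OF bracket_linear_right])
      (simp add: split bvec_def wt_def)
qed

lemma coord_bracket_e:
  assumes "2 \<le> i" "i \<le> n"
  shows "coord j (bracket (e i) u) =
    (if j = i then wt i * coord 0 u else if j = i + 1 \<and> i < n then coord 1 u else 0)"
  using assms by (auto simp: bracket_e_expand)

lemma coord_bracket: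
  assumes "1 \<le> n"
  shows "coord j (bracket u v) = wt j * (coord j u * coord 0 v - coord j v * coord 0 u) +
    (if 3 \<le> j \<and> j \<le> n then coord (j - 1) u * coord 1 v - coord (j - 1) v * coord 1 u else 0)"
proof -
  have split: "{..n} = insert 0 (insert 1 {2..n})" using assms by auto
  have "(\<Sum>i=2..n. coord i u * coord j (bracket (e i) v)) =
    (\<Sum>i=2..n. (if i = j then coord j u * wt j * coord 0 v else 0) +
      (if i = j - 1 then (if 3 \<le> j \<and> j \<le> n then coord (j - 1) u * coord 1 v else 0) else 0))"
    by (intro sum.cong refl) (auto simp: coord_bracket_e)
  \<comment> \<open>The first term can do without the bound \<open>n\<close> on \<open>j\<close>,
    because \<open>coord j u\<close> is 0 beyond it.\<close>
  also have "\<dots> = (if 2 \<le> j then coord j u * wt j * coord 0 v else 0) +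
      (if 3 \<le> j \<and> j \<le> n then coord (j - 1) u * coord 1 v else 0)"
    unfolding sum.distrib by (subst (1 2) sum.delta) (auto simp: coord_def)
  finally have high: "(\<Sum>i=2..n. coord i u * coord j (bracket (e i) v)) = \<dots>" .
  have "coord j (bracket u v) = (\<Sum>i\<le>n. coord i u * coord j (bracket (bvec i) v))"
    by (subst linear_expand[OF bracket_linear_left]) simp
  also have "\<dots> = coord 0 u * coord j (bracket x v) + coord 1 u * coord j (bracket (e 1) v) +
      (\<Sum>i=2..n. coord i u * coord j (bracket (e i) v))"
    unfolding split by (auto simp: bvec_pos intro!: sum.cong)
  finally show ?thesis
    unfolding high bracket_antisym[of x v] bracket_antisym[of "e 1" v]
    using assms by (auto simp: coord_bracket_x coord_bracket_e1 wt_def algebra_simps)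
qed

text \<open>The automorphism fixing \<open>x\<close> and \<open>e 1\<close> and multiplying every \<open>e i\<close> with \<open>2 \<le> i\<close> by \<open>c\<close>.\<close>

definition dilation :: "complex \<Rightarrow> 'a \<Rightarrow> 'a" where
  "dilation c u = scale c u + scale ((1 - c) * coord 0 u) x + scale ((1 - c) * coord 1 u) (e 1)"

lemma coord_dilation:
  "1 \<le> n \<Longrightarrow> coord j (dilation c u) = (if j \<le> 1 then coord j u else c * coord j u)"
  unfolding dilation_def coord_add coord_scale
  by (cases "j = 0"; cases "j = 1") (auto simp: algebra_simps)

lemma linear_dilation: "Vector_Spaces.linear scale scale (dilation c)"
  by unfold_locales (simp_all add: dilation_def algebra_simps)

lemma dilation_inverse: "1 \<le> n \<Longrightarrow> c \<noteq> 0 \<Longrightarrow> dilation c (dilation (1 / c) u) = u"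
  by (rule coord_eqI) (simp add: coord_dilation)

text \<open>The vectors \<open>e 2\<close>, ..., \<open>e n\<close> span an abelian ideal, and
  \<open>x\<close> and \<open>e 1\<close> span a complementary subalgebra; scaling the ideal while
  fixing the subalgebra therefore respects brackets.\<close>

lemma dilation_bracket:
  "1 \<le> n \<Longrightarrow> dilation c (bracket u v) = bracket (dilation c u) (dilation c v)"
  by (rule coord_eqI) (auto simp: coord_dilation coord_bracket wt_def algebra_simps)

end

section \<open>Half-derivations\<close>

definition (in s1_algebra) half_derivation :: "('a \<Rightarrow> 'a) \<Rightarrow> bool" where
  "half_derivation f \<longleftrightarrow> Vector_Spaces.linear scale scale f \<and>
    (\<forall>u v. scale 2 (f (bracket u v)) = bracket (f u) v + bracket u (f v))"

locale half_derivation_s1 = s1_algebra +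
  fixes f :: "'a \<Rightarrow> 'a"
  assumes n5: "5 \<le> n" and half_derivation: "half_derivation f"
begin

sublocale f: Vector_Spaces.linear scale scale f
  using half_derivation by (simp add: half_derivation_def)

lemma half_leibniz: "scale 2 (f (bracket u v)) = bracket (f u) v + bracket u (f v)"
  using half_derivation by (simp add: half_derivation_def)

lemma coord_half_leibniz:
  "2 * coord j (f (bracket u v)) = coord j (bracket (f u) v) + coord j (bracket u (f v))"
  by (metis coord_add coord_scale half_leibniz)

section \<open>The half-derivation identity on pairs of basis vectors\<close>

lemma eq_e1_x:
  "2 * coord j (f (e 1)) = wt j * coord j (f (e 1)) -
    (if j = 1 then - coord 0 (f x) else if 3 \<le> j \<and> j \<le> n then coord (j - 1) (f x) else 0)"
  using coord_half_leibniz[of j "e 1" x] n5 bracket_antisym[of "e 1" "f x"]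
  by (simp add: coord_bracket_x coord_bracket_e1 bracket_e1_x)

lemma eq_e_x:
  assumes "2 \<le> i" "i \<le> n"
  shows "2 * wt i * coord j (f (e i)) = wt j * coord j (f (e i)) +
    (if j = i then wt i * coord 0 (f x) else if j = i + 1 \<and> i < n then coord 1 (f x) else 0)"
proof -
  have "bracket (e i) x = scale (wt i) (e i)" using assms by (simp add: bracket_e_x wt_def)
  then show ?thesis
    using coord_half_leibniz[of j "e i" x] assms
    by (simp add: coord_bracket_x coord_bracket_e f.scale mult.assoc)
qed

lemma coord_f_e1_0 [simp]: "coord 0 (f (e 1)) = 0"
  using eq_e1_x[of 0] by (simp add: wt_def)

lemma coord_f_e1_1: "coord 1 (f (e 1)) = coord 0 (f x)"
  using eq_e1_x[of 1] by (simp add: wt_def)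

lemma coord_f_e1_2: "(2 - \<beta>) * coord 2 (f (e 1)) = 0"
  using eq_e1_x[of 2] by (simp add: wt_def algebra_simps)

text \<open>The factor is \<open>wt (t + 1) - 2\<close>. Taking \<open>t = n\<close> would need a
  coordinate \<open>n + 1\<close>, so the \<open>e n\<close> coordinate of \<open>f x\<close> stays
  free; this is the origin of the parameters \<open>b3\<close>, \<open>b4\<close> and
  \<open>b5\<close>.\<close>

lemma coord_f_x:
  assumes "2 \<le> t" "t < n"
  shows "coord t (f x) = (of_nat t - 3 + \<beta>) * coord (t + 1) (f (e 1))"
  using eq_e1_x[of "t + 1"] assms by (simp add: wt_def algebra_simps)

lemma eq_e_e1:
  assumes "2 \<le> i" "i < n"
  shows "2 * coord j (f (e (i + 1))) =
    (if j = 1 then - coord 0 (f (e i)) else if 3 \<le> j \<and> j \<le> n then coord (j - 1) (f (e i)) else 0) +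
    (if j = i + 1 then coord 0 (f x) else 0)"
  using coord_half_leibniz[of j "e i" "e 1"] assms coord_f_e1_1
  by (simp add: coord_bracket_e1 coord_bracket_e bracket_e_e1)

lemma eq_en_e1:
  "(if j = 1 then - coord 0 (f (e n)) else if 3 \<le> j \<and> j \<le> n then coord (j - 1) (f (e n)) else 0) = 0"
  using coord_half_leibniz[of j "e n" "e 1"] n5
  by (cases "j = n") (simp_all add: coord_bracket_e1 coord_bracket_e bracket_en_e1)

lemma eq_e_e:
  assumes "2 \<le> i" "i \<le> n" "2 \<le> j" "j \<le> n"
  shows "(if k = j then wt j * coord 0 (f (e i)) else if k = j + 1 \<and> j < n then coord 1 (f (e i)) else 0)
    = (if k = i then wt i * coord 0 (f (e j)) else if k = i + 1 \<and> i < n then coord 1 (f (e j)) else 0)"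
proof -
  have "coord k (bracket (e j) (f (e i))) = coord k (bracket (e i) (f (e j)))"
    using coord_half_leibniz[of k "e i" "e j"] bracket_antisym[of "f (e i)" "e j"] assms
    by (simp add: bracket_e_e)
  then show ?thesis using assms by (simp add: coord_bracket_e)
qed

section \<open>The images of \<open>e 2\<close>, ..., \<open>e n\<close> under a
  half-derivation\<close>

lemma coord_f_e_0_ge3: "3 \<le> i \<Longrightarrow> i \<le> n \<Longrightarrow> coord 0 (f (e i)) = 0"
  using eq_e_e1[of "i - 1" 0] by simp

lemma coord_f_e_1:
  assumes "2 \<le> i" "i \<le> n"
  shows "coord 1 (f (e i)) = 0"
proof -
  have ge4: "coord 1 (f (e i)) = 0" if "4 \<le> i" "i \<le> n" for i
    using that eq_e_e1[of "i - 1" 1] coord_f_e_0_ge3[of "i - 1"] by simp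
  \<comment> \<open>The commuting pair \<open>e i\<close>, \<open>e 4\<close> is compared at
    coordinate 5: bracketing \<open>e 4\<close> with the \<open>e 1\<close> part of
    \<open>f (e i)\<close> reaches \<open>e 5\<close>, while the other side has no
    \<open>e 5\<close> part. This uses \<open>n\<close> at least 5.\<close>
  have "coord 1 (f (e 2)) = 0" using eq_e_e[of 2 4 5] n5 by simp
  moreover have "coord 1 (f (e 3)) = 0" using eq_e_e[of 3 4 5] n5 by simp
  ultimately show ?thesis using assms ge4[of i] by (cases "i = 2 \<or> i = 3") auto
qed

lemma coord_f_e_0:
  assumes "2 \<le> i" "i \<le> n"
  shows "coord 0 (f (e i)) = 0"
proof (cases "i = 2")
  case True
  then show ?thesis using eq_e_e1[of 2 1] coord_f_e_1[of 3] n5 by simp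
next
  case False
  then show ?thesis using assms coord_f_e_0_ge3 by simp
qed

text \<open>Off the diagonal, the entries of the matrix of \<open>f\<close> on \<open>e 2\<close>,
  ..., \<open>e n\<close> halve with each step along a diagonal, so each diagonal is determined by
  either of its ends.\<close>

lemma shift_entry:
  assumes "2 \<le> i" "i < n" "2 \<le> j" "j < n" "i \<noteq> j"
  shows "coord j (f (e i)) = 2 * coord (j + 1) (f (e (i + 1)))"
  using assms eq_e_e1[of i "j + 1"] by simp

text \<open>Following the diagonal leads to column \<open>n\<close>, where the entries vanish
  because \<open>e n\<close> commutes with \<open>e 1\<close>.\<close>

lemma coord_f_e_below:
  assumes "i \<le> n" "2 \<le> j" "j < i"
  shows "coord j (f (e i)) = 0"
  using assms
proof (induction "n - i" arbitrary: i j)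
  case 0
  then show ?case using eq_en_e1[of "j + 1"] by simp
next
  case (Suc d)
  then show ?case using shift_entry[of i j] Suc.hyps(1)[of "i + 1" "j + 1"] by simp
qed

lemma coord_f_e_above:
  assumes "2 \<le> i" "i + k \<le> n" "1 \<le> k"
  shows "coord (i + k) (f (e i)) = coord (2 + k) (f (e 2)) / 2 ^ (i - 2)"
  using assms
proof (induction i rule: nat_induct_at_least)
  case base
  then show ?case by simp
next
  case (Suc i)
  then have "Suc i - 2 = Suc (i - 2)" by simp
  moreover have "2 * coord (Suc i + k) (f (e (Suc i))) = coord (2 + k) (f (e 2)) / 2 ^ (i - 2)"
    using Suc shift_entry[of i "i + k"] by (simp flip: Suc_eq_plus1)
  ultimately show ?case by (simp only: power_Suc) (simp add: field_simps)
qed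

lemma coord_f_e_diag:
  assumes "2 \<le> i" "i \<le> n"
  shows "coord i (f (e i)) = coord 0 (f x)"
proof -
  let ?d = "coord 2 (f (e 2)) - coord 0 (f x)"
  have diag_step: "2 * (coord (i+1) (f (e (i+1))) - coord 0 (f x)) = coord i (f (e i)) - coord 0 (f x)"
    if "2 \<le> i" "i < n" for i
    using that eq_e_e1[of i "i + 1"] by simp
  \<comment> \<open>The weights of \<open>e 2\<close> and \<open>e 3\<close> are \<beta> and \<beta>
    + 1, which are not both 0. So one of the first two diagonal entries is correct, and
    \<open>diag_step\<close> passes this on to \<open>?d\<close>.\<close>
  have "wt 2 * ?d = 0" using eq_e_x[of 2 2] n5 by (simp add: algebra_simps)
  moreover have "wt 3 * (coord 3 (f (e 3)) - coord 0 (f x)) = 0"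
    using eq_e_x[of 3 3] n5 by (simp add: algebra_simps)
  ultimately have base: "?d = 0" using diag_step[of 2] n5 by (auto simp: wt_def)
  show ?thesis using assms
  proof (induction i rule: nat_induct_at_least)
    case base
    then show ?case using \<open>?d = 0\<close> by simp
  next
    case (Suc i)
    then show ?case using diag_step[of i] by (simp flip: Suc_eq_plus1)
  qed
qed

text \<open>The pairs \<open>e i\<close>, \<open>x\<close> for \<open>i = 2, 3, 4\<close> give
  (\<beta> - 1) a = c, \<beta> a = 2 c and (\<beta> + 1) a = 4 c, where a and c are the two
  coordinates in question. The first two yield a = c, and then the third yields 3 c = 4 c, whatever
  \<beta> is.\<close>

lemma coord_f_e2_3: "coord 3 (f (e 2)) = 0"
  and coord_f_x_1: "coord 1 (f x) = 0"
proof -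
  let ?a = "coord 3 (f (e 2))" and ?c = "coord 1 (f x)"
  have a4: "?a = 2 * coord 4 (f (e 3))" and a5: "?a = 4 * coord 5 (f (e 4))"
    using coord_f_e_above[of 3 1] coord_f_e_above[of 4 1] n5 by (simp_all add: mult.commute)
  have eqs: "2 * \<beta> * ?a = (1 + \<beta>) * ?a + ?c"
    "2 * (1 + \<beta>) * coord 4 (f (e 3)) = (2 + \<beta>) * coord 4 (f (e 3)) + ?c"
    "2 * (2 + \<beta>) * coord 5 (f (e 4)) = (3 + \<beta>) * coord 5 (f (e 4)) + ?c"
    using eq_e_x[of 2 3] eq_e_x[of 3 4] eq_e_x[of 4 5] n5 by (simp_all add: wt_def)
  have 1: "\<beta> * ?a = ?a + ?c" using eqs(1) by (simp add: algebra_simps)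
  have "\<beta> * coord 4 (f (e 3)) = ?c" using eqs(2) by (simp add: algebra_simps)
  then have 2: "\<beta> * ?a = 2 * ?c" by (subst a4) simp
  have c: "?c = \<beta> * coord 5 (f (e 4)) + coord 5 (f (e 4))" using eqs(3) by (simp add: algebra_simps)
  have 3: "\<beta> * ?a + ?a = 4 * ?c" by (subst (1 2) a5, subst c) (simp add: algebra_simps)
  have a: "?a = ?c" using 1 2 by simp
  have "2 * ?c + ?c = 4 * ?c" using 3 unfolding 2 unfolding a .
  then show "?c = 0" by simp
  with a show "?a = 0" by simp
qed

text \<open>Columns 2 and 3 contain the same entry up to a factor 2, but compare it with weights
  that differ by 1, so it is annihilated by two consecutive numbers. For \<open>j = n\<close> the
  entry in column 3 does not exist, hence the exception in \<open>coord_f_e2_n\<close>.\<close>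

lemma coord_f_e2_mid:
  assumes "3 \<le> j" "j < n"
  shows "coord j (f (e 2)) = 0"
proof (cases "j = 3")
  case False
  have "(\<beta> + 2 - of_nat j) * coord j (f (e 2)) = 0"
    using eq_e_x[of 2 j] assms False n5 by (simp add: wt_def algebra_simps)
  moreover have "(\<beta> + 3 - of_nat j) * coord j (f (e 2)) = 0"
    using eq_e_x[of 3 "j + 1"] shift_entry[of 2 j] assms False n5 by (simp add: wt_def algebra_simps)
  ultimately show ?thesis by algebra
qed (simp add: coord_f_e2_3)

lemma coord_f_e2_n:
  assumes "\<beta> \<noteq> of_nat n - 2"
  shows "coord n (f (e 2)) = 0"
proof -
  have "(\<beta> - (of_nat n - 2)) * coord n (f (e 2)) = 0"
    using eq_e_x[of 2 n] n5 by (simp add: wt_def algebra_simps)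
  then show ?thesis using assms by simp
qed

lemma f_e_ge3:
  assumes "3 \<le> i" "i \<le> n"
  shows "f (e i) = scale (coord 0 (f x)) (e i)"
proof (rule coord_eqI)
  fix j assume "j \<le> n"
  consider "j = 0" | "j = 1" | "2 \<le> j" "j < i" | "j = i" | "i < j" by linarith
  then show "coord j (f (e i)) = coord j (scale (coord 0 (f x)) (e i))"
  proof cases
    case 5
    \<comment> \<open>An entry above the diagonal comes from row \<open>2 + (j - i)\<close> of
      column 2, and this row is less than \<open>n\<close> since \<open>i\<close> is at least
      3.\<close>
    then show ?thesis
      using coord_f_e_above[of i "j - i"] coord_f_e2_mid[of "2 + (j - i)"] assms \<open>j \<le> n\<close> by simp
  qed (use assms coord_f_e_0[of i] coord_f_e_1[of i] coord_f_e_below[of i j] coord_f_e_diag[of i] in auto)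
qed

lemma f_e2: "f (e 2) = scale (coord 0 (f x)) (e 2) + scale (coord n (f (e 2))) (e n)"
proof (rule coord_eqI)
  fix j assume "j \<le> n"
  consider "j = 0" | "j = 1" | "j = 2" | "3 \<le> j" "j < n" | "j = n" using \<open>j \<le> n\<close> by linarith
  then show "coord j (f (e 2)) = coord j (scale (coord 0 (f x)) (e 2) + scale (coord n (f (e 2))) (e n))"
    by cases (use n5 coord_f_e_0[of 2] coord_f_e_1[of 2] coord_f_e_diag[of 2] coord_f_e2_mid[of j] in auto)
qed

end

section \<open>Transposed Poisson structures\<close>

context transposed_poisson_algebra
begin

lemma mult_linear_left: "Vector_Spaces.linear scale scale (\<lambda>u. mult u v)"
  and mult_linear_right: "Vector_Spaces.linear scale scale (\<lambda>v. mult u v)"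
  using mult_bilinear by (auto simp: bilinear_op_def)

text \<open>This supplies the new structure when a multiplication is normalised by an automorphism
  \<open>f\<close> with inverse \<open>g\<close>.\<close>

lemma transport_structure:
  assumes f: "Vector_Spaces.linear scale scale f" and g: "Vector_Spaces.linear scale scale g"
    and fg: "\<And>u. f (g u) = u" and gf: "\<And>u. g (f u) = u"
    and f_bracket: "\<And>u v. f (bracket u v) = bracket (f u) (f v)"
  shows "transposed_poisson_algebra scale bracket (\<lambda>u v. f (mult (g u) (g v)))"
    and "tp_isomorphism scale bracket mult scale bracket (\<lambda>u v. f (mult (g u) (g v))) f"
proof -
  interpret f: Vector_Spaces.linear scale scale f by fact
  have g_bracket: "g (bracket u v) = bracket (g u) (g v)" for u v
    by (metis fg gf f_bracket)
  have lin: "Vector_Spaces.linear scale scale (\<lambda>v. f (h (g v)))"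
    if "Vector_Spaces.linear scale scale h" for h
    using Vector_Spaces.linear_compose[OF Vector_Spaces.linear_compose[OF g that] f] by (simp add: o_def)
  show "transposed_poisson_algebra scale bracket (\<lambda>u v. f (mult (g u) (g v)))"
  proof unfold_locales
    show "bilinear_op scale (\<lambda>u v. f (mult (g u) (g v)))"
      unfolding bilinear_op_def
      using lin[OF mult_linear_left] lin[OF mult_linear_right] by blast
    show "f (mult (g u) (g v)) = f (mult (g v) (g u))" for u v
      by (simp add: mult_commute)
    show "f (mult (g (f (mult (g u) (g v)))) (g w)) = f (mult (g u) (g (f (mult (g v) (g w)))))" for u v w
      by (simp add: gf mult_assoc)
    show "scale 2 (f (mult (g z) (g (bracket u v)))) =
        bracket (f (mult (g z) (g u))) v + bracket u (f (mult (g z) (g v)))" for z u v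
    proof -
      have "scale 2 (f (mult (g z) (g (bracket u v)))) =
          f (bracket (mult (g z) (g u)) (g v) + bracket (g u) (mult (g z) (g v)))"
        by (simp add: g_bracket transposed_leibniz flip: f.scale)
      then show ?thesis by (simp add: f.add f_bracket fg)
    qed
  qed
  have "bij f" by (rule o_bij[of g]) (auto simp: fg gf)
  then show "tp_isomorphism scale bracket mult scale bracket (\<lambda>u v. f (mult (g u) (g v))) f"
    unfolding tp_isomorphism_def using f f_bracket gf by simp
qed

end

locale transposed_poisson_s1 =
  s1_algebra scale bracket n \<beta> e x + transposed_poisson_algebra scale bracket mult
  for scale :: "complex \<Rightarrow> 'a::ab_group_add \<Rightarrow> 'a" and bracket n \<beta> e x mult +
  assumes n_ge_5: "5 \<le> n"
begin

section \<open>Vanishing products and products with \<open>e 2\<close>\<close>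

sublocale half: half_derivation_s1 scale bracket n \<beta> e x "mult z" for z
  by unfold_locales (auto simp: n_ge_5 half_derivation_def mult_linear_right transposed_leibniz)

lemma coord_0_mult_x [simp]: "coord 0 (mult z x) = 0"
proof -
  have e1: "coord 0 (mult x (e 1)) = 0" by simp
  have ge2: "coord 0 (mult x (e i)) = 0" if "2 \<le> i" "i \<le> n" for i
    using half.coord_f_e_0 that by simp
  \<comment> \<open>The scalar part of multiplication by \<open>e 1\<close> is the \<open>x\<close>
    coordinate of \<open>mult (e 1) x\<close>, which is 0 by \<open>e1\<close>.\<close>
  have "mult (e 1) (e 3) = 0"
    using half.f_e_ge3[of 3 "e 1"] n_ge_5 e1 by (simp add: mult_commute[of "e 1" x])
  then have "coord 3 (mult (e 3) x) = 0"
    using half.coord_f_x[of 3 "e 3"] n_ge_5 by (simp add: mult_commute[of "e 3" "e 1"])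
  \<comment> \<open>The \<open>e 3\<close> coordinate of \<open>mult (e 3) x\<close> is now read as
    a diagonal entry of multiplication by \<open>x\<close>, where it equals the scalar part of that
    operator.\<close>
  then have "coord 0 (mult x x) = 0"
    using half.coord_f_e_diag[of 3 x] n_ge_5 by (simp add: mult_commute[of "e 3" x])
  then have "coord 0 (mult x (bvec j)) = 0" if "j \<le> n" for j
    using that e1 ge2[of j] by (cases "j = 0"; cases "j = 1") (auto simp: bvec_pos)
  then have "coord 0 (mult x z) = 0"
    by (subst linear_expand[OF mult_linear_right]) simp
  then show ?thesis by (simp add: mult_commute)
qed

lemma mult_e_ge3: "3 \<le> i \<Longrightarrow> i \<le> n \<Longrightarrow> mult z (e i) = 0"
  using half.f_e_ge3[of i z] by simp

lemma mult_e2: "mult z (e 2) = scale (coord n (mult z (e 2))) (e n)"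
  using half.f_e2[of z] by simp

lemma mult_e2_x: "mult (e 2) x = scale (coord n (mult (e 2) x)) (e n)"
  using mult_e2[of x] mult_commute[of "e 2" x] by metis

lemma mult_e2_eq_0: "\<beta> \<noteq> of_nat n - 2 \<Longrightarrow> mult z (e 2) = 0"
  using mult_e2[of z] half.coord_f_e2_n[of z] by simp

lemma mult_e1_e2: "mult (e 1) (e 2) = 0"
proof (cases "\<beta> = of_nat n - 2")
  case True
  have "coord (n - 1) (mult (e 2) x) = 0"
    using arg_cong[OF mult_e2[of x], of "coord (n - 1)"] n_ge_5
    by (cases "n = n - 1") (simp_all add: mult_commute[of "e 2" x])
  moreover have "of_nat (n - 1) - 3 + \<beta> \<noteq> 0"
  proof -
    \<comment> \<open>This is the factor linking coordinate \<open>n - 1\<close> of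
      \<open>mult (e 2) x\<close>, which is 0, to coordinate \<open>n\<close> of
      \<open>mult (e 2) (e 1)\<close>.\<close>
    have "of_nat (n - 1) - 3 + \<beta> = of_nat (2 * (n - 3))"
      using True n_ge_5 by (simp add: of_nat_diff)
    then show ?thesis using n_ge_5 by (simp only: of_nat_eq_0_iff)
  qed
  moreover have "2 \<le> n - 1" "n - 1 < n" "n - 1 + 1 = n" using n_ge_5 by auto
  ultimately have "coord n (mult (e 2) (e 1)) = 0"
    using half.coord_f_x[of "n - 1" "e 2"] by (simp only: mult_eq_0_iff) simp
  then show ?thesis using mult_e2[of "e 1"] by (simp add: mult_commute[of "e 2" "e 1"])
qed (rule mult_e2_eq_0)

lemma mult_expand:
  "mult z u = scale (coord 0 u) (mult z x) + scale (coord 1 u) (mult z (e 1)) +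
    scale (coord 2 u) (mult z (e 2))"
proof -
  have split: "{..n} = {0, 1, 2} \<union> {3..n}" using n_ge_5 by auto
  have "(\<Sum>j\<in>{3..n}. scale (coord j u) (mult z (bvec j))) = 0"
    by (intro sum.neutral) (auto simp: bvec_pos mult_e_ge3)
  then show ?thesis
    by (subst linear_expand[OF mult_linear_right], unfold split, subst sum.union_disjoint)
      (auto simp: bvec_pos add.assoc)
qed

section \<open>The products of \<open>e 1\<close> and \<open>x\<close>\<close>

abbreviation \<alpha> :: "nat \<Rightarrow> complex" where
  "\<alpha> j \<equiv> coord j (mult (e 1) (e 1))"

abbreviation b3 :: complex where
  "b3 \<equiv> coord n (mult (e 1) x)"

lemma alpha_1: "\<alpha> 1 = 0"
  using half.coord_f_e1_1[of "e 1"] by simp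

lemma alpha_2: "\<beta> \<noteq> 2 \<Longrightarrow> \<alpha> 2 = 0"
  using half.coord_f_e1_2[of "e 1"] by simp

lemma coord_e1_x:
  "2 \<le> t \<Longrightarrow> t < n \<Longrightarrow> coord t (mult (e 1) x) = (of_nat t - 3 + \<beta>) * \<alpha> (t + 1)"
  by (rule half.coord_f_x)

text \<open>The \<open>e 2\<close> coordinate of \<open>mult (e 1) x\<close> is computed twice:
  multiplication by \<open>x\<close> makes it 0 unless \<beta> = 2, and multiplication by
  \<open>e 1\<close> makes it (\<beta> - 1) times the coefficient in question.\<close>

lemma alpha_3:
  assumes "\<beta> \<noteq> 1" "\<beta> \<noteq> 2"
  shows "\<alpha> 3 = 0"
proof -
  have "coord 2 (mult (e 1) x) = 0"
    using half.coord_f_e1_2[of x] assms by (simp add: mult_commute[of "e 1" x])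
  then show ?thesis using coord_e1_x[of 2] n_ge_5 assms by simp
qed

lemma coord_x_x:
  assumes "2 \<le> t" "t \<le> n - 2"
  shows "coord t (mult x x) = (of_nat t - 3 + \<beta>) * (of_nat t - 2 + \<beta>) * \<alpha> (t + 2)"
proof -
  have "t + 1 + 1 = t + 2" by simp
  then show ?thesis
    using assms n_ge_5 half.coord_f_x[of t x] coord_e1_x[of "t + 1"]
    by (simp only: mult_commute[of x "e 1"]) simp
qed

lemma coord_x_x_pred: "coord (n - 1) (mult x x) = (of_nat n - 4 + \<beta>) * b3"
  using n_ge_5 half.coord_f_x[of "n - 1" x]
  by (simp add: mult_commute[of x "e 1"] of_nat_diff)

text \<open>Reduces the check of unlisted products to pairs from \<open>x\<close>,
  \<open>e 1\<close> and \<open>e 2\<close>.\<close>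

lemma basis_cases:
  assumes "u \<in> insert x (e ` {1..n})"
  shows "u = x \<or> u = e 1 \<or> u = e 2 \<or> (\<forall>z. mult z u = 0 \<and> mult u z = 0)"
proof -
  consider "u = x" | i where "i \<in> {1..n}" "u = e i" using assms by blast
  then show ?thesis
  proof cases
    case (2 i)
    then consider "i = 1" | "i = 2" | "3 \<le> i" by force
    then show ?thesis using 2 mult_e_ge3[of i] by cases (auto simp: mult_commute[of "e i"])
  qed simp
qed

lemma other_products_zero_e1_x:
  assumes "\<beta> \<noteq> of_nat n - 2"
  shows "other_products_zero mult (insert x (e ` {1..n})) {(e 1, e 1), (e 1, x), (x, x)}"
  unfolding other_products_zero_def
proof (intro ballI impI)
  fix u v assume basis: "u \<in> insert x (e ` {1..n})" "v \<in> insert x (e ` {1..n})"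
    and "(u, v) \<notin> {(e 1, e 1), (e 1, x), (x, x)} \<and> (v, u) \<notin> {(e 1, e 1), (e 1, x), (x, x)}"
  from this(3) basis_cases[OF basis(1)] basis_cases[OF basis(2)] show "mult u v = 0"
    by (-, elim disjE) (simp_all add: mult_e2_eq_0[OF assms] mult_commute[of "e 2"])
qed

lemma e1_e1_eq:
  assumes "1 \<le> m" "\<And>j. j < m \<Longrightarrow> \<alpha> j = 0"
  shows "mult (e 1) (e 1) = (\<Sum>j=m..n. scale (\<alpha> j) (e j))"
  using assms by (intro coord_eqI) (auto simp: coord_sum_e simp del: coord_sum)

text \<open>The start \<open>m\<close> and the coefficients \<open>p\<close> are left open because
  the normal forms omit different vanishing terms and write the coefficients differently; likewise
  \<open>m\<close>, \<open>q\<close> and \<open>r\<close> in \<open>x_x_eq\<close>.\<close>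

lemma e1_x_eq:
  assumes "2 \<le> m" "m \<le> n"
    and "\<And>t. 2 \<le> t \<Longrightarrow> t < m \<Longrightarrow> (of_nat t - 3 + \<beta>) * \<alpha> (t + 1) = 0"
    and "\<And>t. m \<le> t \<Longrightarrow> t < n \<Longrightarrow> p t = (of_nat t - 3 + \<beta>) * \<alpha> (t + 1)"
  shows "mult (e 1) x = (\<Sum>t=m..n-1. scale (p t) (e t)) + scale b3 (e n)"
proof (rule coord_eqI)
  fix j assume "j \<le> n"
  consider "j = 0" | "j = 1" | "2 \<le> j" "j < m" | "m \<le> j" "j < n" | "j = n"
    using \<open>j \<le> n\<close> by linarith
  then show "coord j (mult (e 1) x) = coord j ((\<Sum>t=m..n-1. scale (p t) (e t)) + scale b3 (e n))"
    by cases (use assms n_ge_5 half.coord_f_x_1[of "e 1"] coord_e1_x[of j]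
        in \<open>auto simp: coord_sum_e simp del: coord_sum\<close>)
qed

lemma x_x_eq:
  assumes "2 \<le> m" "m \<le> n - 1"
    and "\<And>t. 2 \<le> t \<Longrightarrow> t < m \<Longrightarrow> (of_nat t - 3 + \<beta>) * (of_nat t - 2 + \<beta>) * \<alpha> (t + 2) = 0"
    and "\<And>t. m \<le> t \<Longrightarrow> t \<le> n - 2 \<Longrightarrow>
      q t = (of_nat t - 3 + \<beta>) * (of_nat t - 2 + \<beta>) * \<alpha> (t + 2)"
    and "r = of_nat n - 4 + \<beta>"
  shows "mult x x = (\<Sum>t=m..n-2. scale (q t) (e t)) + scale (r * b3) (e (n - 1)) +
    scale (coord n (mult x x)) (e n)"
proof (rule coord_eqI)
  fix j assume "j \<le> n"
  consider "j = 0" | "j = 1" | "2 \<le> j" "j < m" | "m \<le> j" "j \<le> n - 2" | "j = n - 1" | "j = n"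
    using \<open>j \<le> n\<close> by linarith
  then show "coord j (mult x x) = coord j ((\<Sum>t=m..n-2. scale (q t) (e t)) +
      scale (r * b3) (e (n - 1)) + scale (coord n (mult x x)) (e n))"
    by cases (use assms n_ge_5 half.coord_f_x_1[of x] coord_x_x[of j] coord_x_x_pred
        in \<open>auto simp: coord_sum_e simp del: coord_sum\<close>)
qed

lemma alpha_low:
  assumes "\<beta> \<noteq> 2" "j < 3"
  shows "\<alpha> j = 0"
proof -
  have "j = 0 \<or> j = 1 \<or> j = 2" using assms by linarith
  then show ?thesis using assms alpha_1 alpha_2 by auto
qed

lemma alpha_low':
  assumes "\<beta> \<noteq> 1" "\<beta> \<noteq> 2" "j < 4"
  shows "\<alpha> j = 0"
  using assms alpha_low alpha_3 by (cases "j = 3") auto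

section \<open>The normal forms for \<beta> other than n - 2\<close>

lemma TP1I:
  assumes "\<beta> = 1"
  shows "TP1 scale n e x mult"
proof -
  have "\<beta> \<noteq> of_nat n - 2"
  proof
    assume "\<beta> = of_nat n - 2"
    then have "of_nat n = (of_nat 3 :: complex)" using assms by (simp add: algebra_simps)
    then show False using n_ge_5 by (simp only: of_nat_eq_iff)
  qed
  then show ?thesis
    unfolding TP1_def using assms n_ge_5
    by (intro exI[of _ "\<alpha>"] exI[of _ b3] exI[of _ "coord n (mult x x)"] conjI
        e1_e1_eq e1_x_eq x_x_eq other_products_zero_e1_x)
      (auto simp: alpha_low)
qed

lemma TP2I:
  assumes "\<beta> = 2"
  shows "TP2 scale n e x mult"
proof -
  have "\<beta> \<noteq> of_nat n - 2"
  proof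
    assume "\<beta> = of_nat n - 2"
    then have "of_nat n = (of_nat 4 :: complex)" using assms by (simp add: algebra_simps)
    then show False using n_ge_5 by (simp only: of_nat_eq_iff)
  qed
  moreover have "\<alpha> j = 0" if "j < 2" for j
  proof -
    have "j = 0 \<or> j = 1" using that by linarith
    then show ?thesis using alpha_1 by auto
  qed
  ultimately show ?thesis
    unfolding TP2_def using assms n_ge_5
    by (intro exI[of _ "\<alpha>"] exI[of _ b3] exI[of _ "coord n (mult x x)"] conjI
        e1_e1_eq e1_x_eq x_x_eq other_products_zero_e1_x)
      (auto simp: power2_eq_square algebra_simps)
qed

lemma TP5I:
  assumes "\<beta> \<noteq> 1" "\<beta> \<noteq> 2" "\<beta> \<noteq> of_nat n - 2"
  shows "TP5 scale n \<beta> e x mult"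
  unfolding TP5_def using assms n_ge_5
  by (intro exI[of _ "\<alpha>"] exI[of _ b3] exI[of _ "coord n (mult x x)"] conjI
      e1_e1_eq e1_x_eq x_x_eq other_products_zero_e1_x)
    (auto simp: alpha_low')

section \<open>The case \<beta> = n - 2\<close>

context
  assumes \<beta>: "\<beta> = of_nat n - 2"
begin

lemma beta_ne: "\<beta> \<noteq> 0" "\<beta> \<noteq> 1" "\<beta> \<noteq> 2"
proof -
  have eq: "\<beta> = of_nat (n - 2)" using \<beta> n_ge_5 by (simp add: of_nat_diff)
  have "\<beta> \<noteq> of_nat 0" "\<beta> \<noteq> of_nat 1" "\<beta> \<noteq> of_nat 2"
    unfolding eq of_nat_eq_iff using n_ge_5 by auto
  then show "\<beta> \<noteq> 0" "\<beta> \<noteq> 1" "\<beta> \<noteq> 2" by simp_all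
qed

text \<open>Associativity of the triple \<open>x, x, e 2\<close> is what separates the two normal forms.\<close>

lemma alpha_4_e2_e2:
  assumes "\<alpha> 4 \<noteq> 0"
  shows "mult (e 2) (e 2) = 0"
proof -
  have "mult (mult x x) (e 2) = mult x (scale (coord n (mult x (e 2))) (e n))"
    unfolding mult_assoc by (subst mult_e2) simp
  also have "\<dots> = 0"
    using mult_e_ge3[of n x] n_ge_5 by (simp add: half.f.scale)
  finally have "mult (e 2) (mult x x) = 0" by (simp add: mult_commute)
  \<comment> \<open>As \<open>mult x x\<close> has no \<open>x\<close> or \<open>e 1\<close> part,
    \<open>mult (e 2) (mult x x)\<close> is this coordinate times \<open>mult (e 2) (e 2)\<close>;
    the factors \<beta> - 1 and \<beta> are nonzero by \<open>beta_ne\<close>.\<close>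
  moreover have "coord 2 (mult x x) = (\<beta> - 1) * \<beta> * \<alpha> 4"
    using coord_x_x[of 2] n_ge_5 by simp
  ultimately have "scale ((\<beta> - 1) * \<beta> * \<alpha> 4) (mult (e 2) (e 2)) = 0"
    using mult_expand[of "e 2" "mult x x"] half.coord_f_x_1[of x] by simp
  then show ?thesis using assms beta_ne by simp
qed

lemma TP3I:
  assumes "\<alpha> 4 = 0"
  shows "TP3 scale n e x mult"
proof -
  have low: "\<alpha> j = 0" if "j < 5" for j
  proof (cases "j = 4")
    case False
    then show ?thesis using that by (intro alpha_low'[OF beta_ne(2,3)]) simp
  qed (simp add: assms)
  have "other_products_zero mult (insert x (e ` {1..n}))
      {(e 1, e 1), (e 1, e 2), (e 2, e 2), (e 1, x), (e 2, x), (x, x)}" (is "other_products_zero _ _ ?L")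
    unfolding other_products_zero_def
  proof (intro ballI impI)
    fix u v assume basis: "u \<in> insert x (e ` {1..n})" "v \<in> insert x (e ` {1..n})"
      and "(u, v) \<notin> ?L \<and> (v, u) \<notin> ?L"
    from this(3) basis_cases[OF basis(1)] basis_cases[OF basis(2)] show "mult u v = 0"
      by (-, elim disjE) simp_all
  qed
  then show ?thesis
    unfolding TP3_def using n_ge_5
    \<comment> \<open>The witness 0 for \<open>b1\<close> comes from
      \<open>mult_e1_e2\<close>.\<close>
    by (intro exI[of _ "\<alpha>"] exI[of _ 0] exI[of _ "coord n (mult (e 2) (e 2))"] exI[of _ b3]
        exI[of _ "coord n (mult (e 2) x)"] exI[of _ "coord n (mult x x)"] conjI
        e1_e1_eq mult_e2 e1_x_eq mult_e2_x x_x_eq)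
      (auto simp: low mult_e1_e2 \<beta> algebra_simps)
qed

lemma TP4I:
  assumes "\<alpha> 4 = 1"
  shows "TP4 scale n e x mult"
proof -
  have low: "\<alpha> j = 0" if "j < 4" for j
    by (rule alpha_low'[OF beta_ne(2,3) that])
  have e2_e2: "mult (e 2) (e 2) = 0" using alpha_4_e2_e2 assms by simp
  have "other_products_zero mult (insert x (e ` {1..n}))
      {(e 1, e 1), (e 1, x), (e 2, x), (x, x)}" (is "other_products_zero _ _ ?L")
    unfolding other_products_zero_def
  proof (intro ballI impI)
    fix u v assume basis: "u \<in> insert x (e ` {1..n})" "v \<in> insert x (e ` {1..n})"
      and "(u, v) \<notin> ?L \<and> (v, u) \<notin> ?L"
    from this(3) basis_cases[OF basis(1)] basis_cases[OF basis(2)] show "mult u v = 0"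
      by (-, elim disjE) (simp_all add: e2_e2 mult_e1_e2 mult_commute[of "e 2" "e 1"])
  qed
  moreover have "mult (e 1) (e 1) = e 4 + (\<Sum>j=5..n. scale (\<alpha> j) (e j))"
    using e1_e1_eq[of 4] low assms n_ge_5 by (simp add: sum.atLeast_Suc_atMost)
  moreover have "mult (e 1) x = scale (of_nat n - 2) (e 3) +
      (\<Sum>t=4..n-1. scale ((of_nat n + of_nat t - 5) * \<alpha> (t + 1)) (e t)) + scale b3 (e n)"
  proof -
    let ?p = "\<lambda>t. (of_nat n + of_nat t - 5) * \<alpha> (t + 1)"
    have "mult (e 1) x = (\<Sum>t=3..n-1. scale (?p t) (e t)) + scale b3 (e n)"
      using low n_ge_5 by (intro e1_x_eq) (auto simp: \<beta> algebra_simps)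
    \<comment> \<open>The leading term, which carries the normalised coefficient 1 of
      \<open>e 4\<close>, is split off; the same happens below for \<open>mult x x\<close>.\<close>
    also have "(\<Sum>t=3..n-1. scale (?p t) (e t)) = scale (?p 3) (e 3) + (\<Sum>t=4..n-1. scale (?p t) (e t))"
      using sum.atLeast_Suc_atMost[of 3 "n - 1" "\<lambda>t. scale (?p t) (e t)"] n_ge_5 by simp
    also have "?p 3 = of_nat n - 2" using assms by simp
    finally show ?thesis .
  qed
  moreover have "mult x x = scale ((of_nat n - 3) * (of_nat n - 2)) (e 2) +
      (\<Sum>t=3..n-2. scale ((of_nat n + of_nat t - 5) * (of_nat n + of_nat t - 4) * \<alpha> (t + 2)) (e t)) +
      scale ((2 * of_nat n - 6) * b3) (e (n - 1)) + scale (coord n (mult x x)) (e n)"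
  proof -
    let ?q = "\<lambda>t. (of_nat n + of_nat t - 5) * (of_nat n + of_nat t - 4) * \<alpha> (t + 2)"
    have "mult x x = (\<Sum>t=2..n-2. scale (?q t) (e t)) + scale ((2 * of_nat n - 6) * b3) (e (n - 1)) +
        scale (coord n (mult x x)) (e n)"
      using n_ge_5 by (intro x_x_eq) (auto simp: \<beta> algebra_simps)
    also have "(\<Sum>t=2..n-2. scale (?q t) (e t)) = scale (?q 2) (e 2) + (\<Sum>t=3..n-2. scale (?q t) (e t))"
      using sum.atLeast_Suc_atMost[of 2 "n - 2" "\<lambda>t. scale (?q t) (e t)"] n_ge_5 by simp
    also have "?q 2 = (of_nat n - 3) * (of_nat n - 2)" using assms by simp
    finally show ?thesis .
  qed
  ultimately show ?thesis
    unfolding TP4_def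
    by (intro exI[of _ "\<alpha>"] exI[of _ b3] exI[of _ "coord n (mult (e 2) x)"]
        exI[of _ "coord n (mult x x)"] conjI mult_e2_x)
qed

lemma TP3_or_TP4:
  "\<exists>mult' \<phi>. transposed_poisson_algebra scale bracket mult' \<and>
    tp_isomorphism scale bracket mult scale bracket mult' \<phi> \<and>
    (TP3 scale n e x mult' \<or> TP4 scale n e x mult')"
proof -
  \<comment> \<open>The dilation fixes \<open>e 1\<close> and scales the \<open>e 4\<close>
    coordinate by \<open>c\<close>, so this \<open>c\<close> turns a nonzero coefficient into 1. If
    the coefficient is 0, the choice 1 makes the dilation the identity.\<close>
  define c where "c = (if \<alpha> 4 = 0 then 1 else 1 / \<alpha> 4)"
  define mult' where "mult' = (\<lambda>u v. dilation c (mult (dilation (1 / c) u) (dilation (1 / c) v)))"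
  have n1: "1 \<le> n" and c: "c \<noteq> 0" using n_ge_5 by (auto simp: c_def)
  have inv: "dilation c (dilation (1 / c) u) = u" "dilation (1 / c) (dilation c u) = u" for u
    using dilation_inverse[OF n1 c] dilation_inverse[OF n1, of "1 / c"] c by simp_all
  note transport = transport_structure[OF linear_dilation linear_dilation inv dilation_bracket[OF n1],
      folded mult'_def]
  interpret M: transposed_poisson_s1 scale bracket n \<beta> e x mult'
    by (intro transposed_poisson_s1.intro transposed_poisson_s1_axioms.intro transport(1)
        s1_algebra_axioms n_ge_5)
  have "dilation (1 / c) (e 1) = e 1"
    using n1 by (intro coord_eqI) (auto simp: coord_dilation)
  then have "M.\<alpha> 4 = c * \<alpha> 4"
    using n1 by (simp add: mult'_def coord_dilation)
  then have "M.\<alpha> 4 = 0 \<or> M.\<alpha> 4 = 1" by (simp add: c_def)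
  then show ?thesis using transport M.TP3I[OF \<beta>] M.TP4I[OF \<beta>] by blast
qed

end

end

theorem theorem3p2:
  fixes scale :: "complex \<Rightarrow> 'a::ab_group_add \<Rightarrow> 'a"
    and bracket mult :: "'a \<Rightarrow> 'a \<Rightarrow> 'a"
    and n :: nat and \<beta> :: complex and e :: "nat \<Rightarrow> 'a" and x :: 'a
  assumes "5 \<le> n"
    and "s1_algebra scale bracket n \<beta> e x"
    and "transposed_poisson_algebra scale bracket mult"
  shows "(\<beta> = 1 \<longrightarrow> TP1 scale n e x mult) \<and>
         (\<beta> = 2 \<longrightarrow> TP2 scale n e x mult) \<and>
         (\<beta> = of_nat n - 2 \<longrightarrow>
            (\<exists>mult' \<phi>. transposed_poisson_algebra scale bracket mult' \<and>
               tp_isomorphism scale bracket mult scale bracket mult' \<phi> \<and>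
               (TP3 scale n e x mult' \<or> TP4 scale n e x mult'))) \<and>
         (\<beta> \<noteq> 1 \<and> \<beta> \<noteq> 2 \<and> \<beta> \<noteq> of_nat n - 2 \<longrightarrow> TP5 scale n \<beta> e x mult)"
proof -
  interpret transposed_poisson_s1 scale bracket n \<beta> e x mult
    using assms by (intro transposed_poisson_s1.intro transposed_poisson_s1_axioms.intro)
  show ?thesis using TP1I TP2I TP3_or_TP4 TP5I by blast
qed

end
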